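(* Let $f:[0,\infty)\to[0,\infty)$ be a locally Lipschitz, convex function with $f(0)=0$, $f(u)>0$ for all $u>0$, $\int_1^\infty \frac{du}{f(u)}<\infty$ and $\lim_{u\to\infty}\frac{f(u)}{u}=+\infty$. Let $(\mathbb{T}_b,\omega_0,\mu_1)$ be a homogeneous tree with root $x_0\in\mathbb{T}_b$ and constant branching $b\in\mathbb{N}$, and let $a>\log(b)$. Let $u_0:\mathbb{T}_b\to[0,+\infty)$ be bounded with $u_0\not\equiv0$, and let $u$ be a solution of $u_t-\Delta u=f(u)$ in $\mathbb{T}_b\times(0,T)$, $u=u_0$ in $\mathbb{T}_b\times\{0\}$, with maximal time of existence $T\in(0,+\infty]$. Define $$\varphi(x):=\bigl(1-b\,e^{-a}\bigr)e^{-a\,r(x)}\qquad\text{for all }x\in\mathbb{T}_b,$$ where $r(x):=\rho(x,x_0)$, and let $\lambda\ge b$. If $$\sum_{x\in\mathbb{T}_b}u_0(x)\,\varphi(x)>s_0(\lambda),\qquad\text{where } s_0(\lambda):=\inf\Bigl\{v>0:\ \frac{f(v)}{v}>\lambda\Bigr\},$$ then $u$ blows up in finite time.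
   Context: $\mathbb{N}=\{1,2,\dots\}$, $\mathbb{N}_0=\mathbb{N}\cup\{0\}$. Weighted graph: $X$ is a countably infinite set, $\mu:X\to(0,+\infty)$, and $\omega:X\times X\to[0,+\infty)$ satisfies $\omega(x,x)=0$, $\omega(x,y)=\omega(y,x)$ and $\sum_{y\in X}\omega(x,y)<+\infty$ for all $x,y\in X$; $x\sim y$ means $\omega(x,y)>0$; $\deg(x):=\sum_{y\in X}\omega(x,y)$. The graph is connected if any two vertices are joined by a finite path; $\rho(x,y)$ is the minimal number of edges in a path from $x$ to $y$ (combinatorial distance). Laplacian: $\Delta g(x):=\frac1{\mu(x)}\sum_{y\in X}\omega(x,y)[g(y)-g(x)]$, acting on the space variable of $u(x,t)$. $\ell^\infty(X)$ is the set of bounded functions on $X$, with the sup norm $\|\cdot\|_\infty$. Model tree with root $x_0$: a connected weighted graph $(\mathbb{T},\omega_0,\mu_1)$ with $x_0\in\mathbb{T}$ such that, with $S_r(x_0):=\{x\in\mathbb{T}:\rho(x,x_0)=r\}$: (a) $\omega_0(x,y)=1$ if $x\sim y$ and $0$ otherwise; (b) $\omega_0(x,y)=0$ for all $x,y\in S_r(x_0)$, for each $r\in\mathbb{N}_0$; (c) $\mu_1\equiv1$; (d) every $x\ne x_0$ has exactly one neighbor $y$ with $\rho(y,x_0)=\rho(x,x_0)-1$; (e) $\deg(x)$ depends only on $\rho(x,x_0)$, written $\deg(r)$ for $x\in S_r(x_0)$. Its branching function $\mathbb{N}_0\to\mathbb{N}$ is $b(0):=\deg(x_0)$ and $b(r):=\deg(r)-1$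 for $r\in\mathbb{N}$. The model tree is homogeneous, written $(\mathbb{T}_b,\omega_0,\mu_1)$, if $b(r)=b$ for all $r\in\mathbb{N}_0$, for some constant $b\in\mathbb{N}$. Solution: a function $u:\mathbb{T}_b\times[0,T)\to\mathbb{R}$ with $u(x,\cdot)\in C^1((0,T))\cap C^0([0,T))$ for all $x$, $u\in L^\infty(\mathbb{T}_b\times[0,T'])$ for all $T'\in(0,T)$, $u\ge0$ in $\mathbb{T}_b\times(0,T)$, and satisfying the equation and the initial condition pointwise. The solution is considered up to its maximal time of existence $T\in(0,+\infty]$, and by convention exactly one of two alternatives holds: either $T=+\infty$ and $u(\cdot,t)\in\ell^\infty(\mathbb{T}_b)$ for all $t>0$ ($u$ is global), or $T<+\infty$ and $\lim_{t\to T^-}\|u(\cdot,t)\|_\infty=+\infty$. "$u$ blows up in finite time" means that the maximal time of existence is finite, $0<T<+\infty$, with $u(\cdot,t)\in\ell^\infty(\mathbb{T}_b)$ for all $t\in(0,T)$ and $\lim_{t\to T^-}\|u(\cdot,t)\|_\infty=+\infty$. *)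

theory Defs
  imports "HOL-Analysis.Analysis"
begin

text \<open>A graph lives on an explicit vertex set \<open>X\<close>; all functions are total on the ambient type
  and only their values on \<open>X\<close> matter.\<close>

locale weighted_graph =
  fixes X :: "'a set" and \<omega> :: "'a \<Rightarrow> 'a \<Rightarrow> real" and \<mu> :: "'a \<Rightarrow> real"
  assumes countable_vertices: "countable X"
    and infinite_vertices: "infinite X"
    and measure_pos: "x \<in> X \<Longrightarrow> 0 < \<mu> x"
    and weight_nonneg: "x \<in> X \<Longrightarrow> y \<in> X \<Longrightarrow> 0 \<le> \<omega> x y"
    and weight_refl: "x \<in> X \<Longrightarrow> \<omega> x x = 0"
    and weight_sym: "x \<in> X \<Longrightarrow> y \<in> X \<Longrightarrow> \<omega> x y = \<omega> y x"
    and weight_summable: "x \<in> X \<Longrightarrow> (\<lambda>y. \<omega> x y) summable_on X"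

definition edges :: "'a set \<Rightarrow> ('a \<Rightarrow> 'a \<Rightarrow> real) \<Rightarrow> ('a \<times> 'a) set" where
  "edges X \<omega> = {(x, y). x \<in> X \<and> y \<in> X \<and> 0 < \<omega> x y}"

definition degree :: "'a set \<Rightarrow> ('a \<Rightarrow> 'a \<Rightarrow> real) \<Rightarrow> 'a \<Rightarrow> real" where
  "degree X \<omega> x = (\<Sum>\<^sub>\<infinity>y\<in>X. \<omega> x y)"

definition graph_connected :: "'a set \<Rightarrow> ('a \<Rightarrow> 'a \<Rightarrow> real) \<Rightarrow> bool" where
  "graph_connected X \<omega> \<longleftrightarrow> (\<forall>x\<in>X. \<forall>y\<in>X. (x, y) \<in> (edges X \<omega>)\<^sup>*)"

text \<open>The \<open>n\<close>-fold relational power of the edge relation relates the endpoints of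
  walks with \<open>n\<close> edges.\<close>

definition comb_dist :: "'a set \<Rightarrow> ('a \<Rightarrow> 'a \<Rightarrow> real) \<Rightarrow> 'a \<Rightarrow> 'a \<Rightarrow> nat" where
  "comb_dist X \<omega> x y = (LEAST n. (x, y) \<in> edges X \<omega> ^^ n)"

definition laplacian ::
  "'a set \<Rightarrow> ('a \<Rightarrow> 'a \<Rightarrow> real) \<Rightarrow> ('a \<Rightarrow> real) \<Rightarrow> ('a \<Rightarrow> real) \<Rightarrow> 'a \<Rightarrow> real" where
  "laplacian X \<omega> \<mu> g x = 1 / \<mu> x * (\<Sum>\<^sub>\<infinity>y\<in>X. \<omega> x y * (g y - g x))"

definition sphere_at :: "'a set \<Rightarrow> ('a \<Rightarrow> 'a \<Rightarrow> real) \<Rightarrow> 'a \<Rightarrow> nat \<Rightarrow> 'a set" where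
  "sphere_at X \<omega> x0 r = {x \<in> X. comb_dist X \<omega> x x0 = r}"

locale model_tree = weighted_graph X \<omega> \<mu>
  for X :: "'a set" and \<omega> :: "'a \<Rightarrow> 'a \<Rightarrow> real" and \<mu> :: "'a \<Rightarrow> real" +
  fixes x0 :: 'a
  assumes root_in: "x0 \<in> X"
    and connected: "graph_connected X \<omega>"
    and unit_weights:
      "x \<in> X \<Longrightarrow> y \<in> X \<Longrightarrow> \<omega> x y = (if (x, y) \<in> edges X \<omega> then 1 else 0)"
    and no_edge_in_sphere:
      "x \<in> sphere_at X \<omega> x0 r \<Longrightarrow> y \<in> sphere_at X \<omega> x0 r \<Longrightarrow> \<omega> x y = 0"
    and unit_measure: "x \<in> X \<Longrightarrow> \<mu> x = 1"
    and unique_parent: "x \<in> X \<Longrightarrow> x \<noteq> x0 \<Longrightarrow>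
      \<exists>!y. (x, y) \<in> edges X \<omega> \<and> comb_dist X \<omega> y x0 + 1 = comb_dist X \<omega> x x0"
    and degree_radial: "x \<in> X \<Longrightarrow> y \<in> X \<Longrightarrow>
      comb_dist X \<omega> x x0 = comb_dist X \<omega> y x0 \<Longrightarrow> degree X \<omega> x = degree X \<omega> y"

text \<open>The common degree of the vertices of a sphere; spheres of model trees are nonempty since
  the vertex set is infinite.\<close>

definition sphere_degree :: "'a set \<Rightarrow> ('a \<Rightarrow> 'a \<Rightarrow> real) \<Rightarrow> 'a \<Rightarrow> nat \<Rightarrow> real" where
  "sphere_degree X \<omega> x0 r = (THE d. \<forall>x\<in>sphere_at X \<omega> x0 r. degree X \<omega> x = d)"

definition branching :: "'a set \<Rightarrow> ('a \<Rightarrow> 'a \<Rightarrow> real) \<Rightarrow> 'a \<Rightarrow> nat \<Rightarrow> real" where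
  "branching X \<omega> x0 r =
     (if r = 0 then degree X \<omega> x0 else sphere_degree X \<omega> x0 r - 1)"

locale homogeneous_tree = model_tree X \<omega> \<mu> x0
  for X :: "'a set" and \<omega> :: "'a \<Rightarrow> 'a \<Rightarrow> real" and \<mu> :: "'a \<Rightarrow> real" and x0 :: 'a +
  fixes b :: nat
  assumes b_pos: "1 \<le> b"
    and branching_const: "branching X \<omega> x0 r = real b"

definition ell_infty :: "'a set \<Rightarrow> ('a \<Rightarrow> real) set" where
  "ell_infty X = {g. bounded (g ` X)}"

text \<open>Only meaningful for members of \<open>ell_infty X\<close>.\<close>

definition sup_norm :: "'a set \<Rightarrow> ('a \<Rightarrow> real) \<Rightarrow> real" where
  "sup_norm X g = (SUP x\<in>X. \<bar>g x\<bar>)"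

text \<open>Essential boundedness on \<open>X \<times> [0,T']\<close> is plain boundedness, since \<open>u(x,\<cdot>)\<close> is continuous
  and the measure on \<open>X\<close> charges every vertex.\<close>

definition is_solution ::
  "'a set \<Rightarrow> ('a \<Rightarrow> 'a \<Rightarrow> real) \<Rightarrow> ('a \<Rightarrow> real) \<Rightarrow> (real \<Rightarrow> real) \<Rightarrow> ('a \<Rightarrow> real) \<Rightarrow>
   ereal \<Rightarrow> ('a \<Rightarrow> real \<Rightarrow> real) \<Rightarrow> bool" where
  "is_solution X \<omega> \<mu> f u0 T u \<longleftrightarrow>
     0 < T \<and>
     (\<forall>x\<in>X. u x C1_differentiable_on {t. 0 < t \<and> ereal t < T}) \<and>
     (\<forall>x\<in>X. continuous_on {t. 0 \<le> t \<and> ereal t < T} (u x)) \<and>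
     (\<forall>T'>0. ereal T' < T \<longrightarrow> bounded ((\<lambda>(x, t). u x t) ` (X \<times> {0..T'}))) \<and>
     (\<forall>x\<in>X. \<forall>t>0. ereal t < T \<longrightarrow> 0 \<le> u x t) \<and>
     (\<forall>x\<in>X. \<forall>t>0. ereal t < T \<longrightarrow>
        deriv (u x) t - laplacian X \<omega> \<mu> (\<lambda>y. u y t) x = f (u x t)) \<and>
     (\<forall>x\<in>X. u x 0 = u0 x)"

definition is_global :: "'a set \<Rightarrow> ereal \<Rightarrow> ('a \<Rightarrow> real \<Rightarrow> real) \<Rightarrow> bool" where
  "is_global X T u \<longleftrightarrow> T = \<infinity> \<and> (\<forall>t>0. (\<lambda>x. u x t) \<in> ell_infty X)"

definition blows_up_in_finite_time :: "'a set \<Rightarrow> ereal \<Rightarrow> ('a \<Rightarrow> real \<Rightarrow> real) \<Rightarrow> bool" where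
  "blows_up_in_finite_time X T u \<longleftrightarrow>
     0 < T \<and> T < \<infinity> \<and>
     (\<forall>t>0. ereal t < T \<longrightarrow> (\<lambda>x. u x t) \<in> ell_infty X) \<and>
     filterlim (\<lambda>t. sup_norm X (\<lambda>x. u x t)) at_top (at_left (real_of_ereal T))"

text \<open>The convention for the maximal time of existence: either \<open>T = \<infinity>\<close>, or \<open>T\<close> is finite and the
  sup norm tends to infinity at \<open>T\<close>. Such a solution indeed has no extension beyond \<open>T\<close>; see
  \<open>maximal_solution_no_extension\<close>.\<close>

definition is_maximal_solution ::
  "'a set \<Rightarrow> ('a \<Rightarrow> 'a \<Rightarrow> real) \<Rightarrow> ('a \<Rightarrow> real) \<Rightarrow> (real \<Rightarrow> real) \<Rightarrow> ('a \<Rightarrow> real) \<Rightarrow>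
   ereal \<Rightarrow> ('a \<Rightarrow> real \<Rightarrow> real) \<Rightarrow> bool" where
  "is_maximal_solution X \<omega> \<mu> f u0 T u \<longleftrightarrow>
     is_solution X \<omega> \<mu> f u0 T u \<and>
     (is_global X T u \<or>
      T < \<infinity> \<and> filterlim (\<lambda>t. sup_norm X (\<lambda>x. u x t)) at_top (at_left (real_of_ereal T)))"

lemma maximal_solution_no_extension:
  assumes "X \<noteq> {}"
    and max: "is_maximal_solution X \<omega> \<mu> f u0 T u"
    and sol: "is_solution X \<omega> \<mu> f u0 T' v" and "T < T'"
    and ext: "\<And>x t. x \<in> X \<Longrightarrow> 0 \<le> t \<Longrightarrow> ereal t < T \<Longrightarrow> v x t = u x t"
  shows False
proof -
  have T: "0 < T" "T < \<infinity>"
    using max \<open>T < T'\<close> by (auto simp: is_maximal_solution_def is_solution_def)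
  then obtain \<tau> where \<tau>: "T = ereal \<tau>" "0 < \<tau>"
    by (cases T) auto
  have lim: "filterlim (\<lambda>t. sup_norm X (\<lambda>x. u x t)) at_top (at_left \<tau>)"
    using max \<tau> by (auto simp: is_maximal_solution_def is_global_def)
  have "bounded ((\<lambda>(x, t). v x t) ` (X \<times> {0..\<tau>}))"
    using sol \<tau> \<open>T < T'\<close> by (auto simp: is_solution_def)
  then obtain M where M: "\<And>x t. x \<in> X \<Longrightarrow> t \<in> {0..\<tau>} \<Longrightarrow> \<bar>v x t\<bar> \<le> M"
    unfolding bounded_iff by fastforce
  have "eventually (\<lambda>t. t \<in> {0<..<\<tau>}) (at_left \<tau>)"
    using \<tau>(2) by (rule eventually_at_leftI[rotated]) auto
  moreover have "eventually (\<lambda>t. M < sup_norm X (\<lambda>x. u x t)) (at_left \<tau>)"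
    using lim by (simp add: filterlim_at_top_dense)
  ultimately have "eventually (\<lambda>t. False) (at_left \<tau>)"
  proof eventually_elim
    case (elim t)
    have "sup_norm X (\<lambda>x. u x t) \<le> M"
      unfolding sup_norm_def
    proof (rule cSUP_least)
      fix x assume "x \<in> X"
      then show "\<bar>u x t\<bar> \<le> M"
        using M[of x t] ext[of x t] elim(1) \<tau> by simp
    qed fact
    with elim(2) show ?case by simp
  qed
  then show False by simp
qed

definition s0 :: "(real \<Rightarrow> real) \<Rightarrow> real \<Rightarrow> real" where
  "s0 f \<Lambda> = Inf {v. 0 < v \<and> \<Lambda> < f v / v}"

end

theory Submission
  imports Defs
begin

text \<open>The proof is Kaplan's method: test the equation against \<open>\<phi>\<close> and reduce it to a scalar
  differential inequality. In place of the full space average of \<open>u\<close>, it uses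
  \<open>g t = (\<Sum>x\<in>B. \<phi> x * u x t)\<close> over a finite ball \<open>B\<close> around the root. For a finite sum there
  are no questions of convergence or of exchanging a sum with a derivative, and yet no boundary
  error arises, because the tree has a direction.

  The reason is as follows. A vertex has degree \<open>b\<close> at the root and \<open>b + 1\<close> elsewhere. In
  \<open>\<Sum>x\<in>B. \<phi> x * \<Delta>u x\<close> the loss at a vertex \<open>y\<close> is \<open>b * \<phi> y * u y\<close>, plus one more \<open>\<phi> y * u y\<close>
  if \<open>y\<close> is not the root. This extra loss is paid by the contribution \<open>\<phi> x * u y\<close> that \<open>y\<close> makes
  at its parent \<open>x\<close>: the parent also lies in \<open>B\<close>, and \<open>\<phi> x \<ge> \<phi> y\<close> since \<open>\<phi>\<close> decreases away from
  the root. The remaining contributions have a good sign as \<open>u \<ge> 0\<close>. This is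
  \<open>sum_laplacian_ball_ge\<close>, and it gives \<open>\<Sum>x\<in>B. \<phi> x * \<Delta>u x \<ge> - b * g\<close>.

  The level sets of the tree have at most \<open>b ^ r\<close> vertices, so the geometric series bounds the
  mass of \<open>\<phi>\<close> on \<open>B\<close> by \<open>1\<close> (\<open>sum_exp_level_le_1\<close>). Jensen's inequality for a subprobability,
  which is available because \<open>f 0 = 0\<close>, then bounds the reaction term from below by \<open>f g\<close>
  (\<open>jensen_subprobability\<close>). As \<open>\<Lambda> \<ge> b\<close>, this gives \<open>g' \<ge> f g - \<Lambda> * g\<close>, and \<open>g 0 > s0 f \<Lambda>\<close> once \<open>B\<close> is large.

  Finally \<open>f v / v\<close> is nondecreasing, so the right-hand side is positive above \<open>s0 f \<Lambda>\<close>; \<open>g\<close>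
  cannot fall below \<open>g 0\<close>, and there \<open>f v - \<Lambda> * v\<close> dominates a fixed positive multiple of \<open>f v\<close>.
  By the Osgood condition on \<open>1 / f\<close>, such a \<open>g\<close> cannot exist for all times
  (\<open>superlinear_ode_no_global_supersolution\<close>). So the solution is not global, and maximality
  leaves only blow-up.\<close>

section \<open>Convex functions vanishing at zero\<close>

lemma convex_slope_mono:
  fixes f :: "real \<Rightarrow> real"
  assumes "convex_on {0..} f" "f 0 = 0" "0 < v" "v \<le> w"
  shows "f v / v \<le> f w / w"
proof -
  have "f ((1 - v / w) *\<^sub>R 0 + (v / w) *\<^sub>R w) \<le> (1 - v / w) * f 0 + (v / w) * f w"
    by (rule convex_onD[OF assms(1)]) (use assms in auto)
  then show ?thesis
    using assms by (simp add: field_simps)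
qed

text \<open>The mass missing from \<open>p\<close> is placed at the point \<open>0\<close>, where \<open>f\<close> vanishes.\<close>

lemma jensen_subprobability:
  fixes f :: "real \<Rightarrow> real"
  assumes f: "convex_on {0..} f" "f 0 = 0"
    and B: "finite B"
    and p: "\<And>x. x \<in> B \<Longrightarrow> 0 < p x" "sum p B \<le> 1"
    and v: "\<And>x. x \<in> B \<Longrightarrow> 0 \<le> v x"
  shows "f (\<Sum>x\<in>B. p x * v x) \<le> (\<Sum>x\<in>B. p x * f (v x))"
proof (cases "B = {}")
  case True
  then show ?thesis using f by simp
next
  case False
  define A where "A = sum p B"
  have A: "0 < A" "A \<le> 1"
    using B False p by (auto simp: A_def intro: sum_pos)
  define m where "m = (\<Sum>x\<in>B. (p x / A) * v x)"
  have "0 \<le> m"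
    unfolding m_def using A p v by (intro sum_nonneg mult_nonneg_nonneg) (auto simp: less_imp_le)
  moreover have "A * m = (\<Sum>x\<in>B. p x * v x)"
    using A by (simp add: m_def sum_distrib_left)
  ultimately have m: "0 \<le> m" "A * m = (\<Sum>x\<in>B. p x * v x)" .
  have "f (A * m) = f ((1 - A) *\<^sub>R 0 + A *\<^sub>R m)"
    by simp
  also have "\<dots> \<le> (1 - A) * f 0 + A * f m"
    by (rule convex_onD[OF f(1)]) (use A m in auto)
  also have "\<dots> = A * f (\<Sum>x\<in>B. (p x / A) *\<^sub>R v x)"
    using f(2) by (simp add: m_def)
  also have "\<dots> \<le> A * (\<Sum>x\<in>B. (p x / A) * f (v x))"
    using A p v B False
    by (intro mult_left_mono convex_on_sum[OF _ _ f(1)])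
      (auto simp: A_def sum_divide_distrib[symmetric] less_imp_le)
  also have "\<dots> = (\<Sum>x\<in>B. p x * f (v x))"
    using A by (simp add: sum_distrib_left)
  finally show ?thesis
    using m by simp
qed

lemma superlinear_threshold_nonempty:
  fixes f :: "real \<Rightarrow> real"
  assumes "filterlim (\<lambda>v. f v / v) at_top at_top"
  shows "{v. 0 < v \<and> \<kappa> < f v / v} \<noteq> {}"
proof -
  have "eventually (\<lambda>v. 0 < v \<and> \<kappa> < f v / v) at_top"
    using assms eventually_gt_at_top[of 0]
    by (auto simp: filterlim_at_top_dense intro: eventually_conj)
  then show ?thesis
    by (auto simp: eventually_at_top_linorder)
qed

text \<open>Since \<open>f v / v\<close> is nondecreasing, the set whose infimum is \<open>s0 f \<kappa>\<close> is upward closed,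
  so it contains everything above its infimum.\<close>

lemma slope_above_threshold:
  assumes f: "convex_on {0..} f" "f 0 = 0"
    and lim: "filterlim (\<lambda>v. f v / v) at_top at_top"
    and v: "s0 f \<kappa> < v"
  shows "0 < v" "\<kappa> < f v / v"
proof -
  from cInf_lessD[OF superlinear_threshold_nonempty[OF lim] v[unfolded s0_def]]
  obtain w where w: "0 < w" "\<kappa> < f w / w" "w < v"
    by auto
  then show "0 < v" "\<kappa> < f v / v"
    using convex_slope_mono[OF f, of w v] by auto
qed

lemma s0_nonneg:
  assumes "filterlim (\<lambda>v. f v / v) at_top at_top"
  shows "0 \<le> s0 f \<kappa>"
  unfolding s0_def using superlinear_threshold_nonempty[OF assms] by (intro cInf_greatest) auto

section \<open>Blow-up for scalar differential inequalities\<close>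

text \<open>Suppose \<open>g t < g 0\<close>. At the last time \<open>r\<close> before \<open>t\<close> at which \<open>g \<ge> g 0\<close>, the function is still
  above \<open>s\<close>; hence it is strictly increasing just after \<open>r\<close>, and \<open>r\<close> was not the last such time.\<close>

lemma derivative_barrier:
  fixes g :: "real \<Rightarrow> real"
  assumes cont: "continuous_on {0..} g"
    and deriv: "\<And>t. 0 < t \<Longrightarrow> (g has_real_derivative g' t) (at t)"
    and pos: "\<And>t. 0 < t \<Longrightarrow> s < g t \<Longrightarrow> 0 < g' t"
    and start: "s < g 0" and "0 \<le> t"
  shows "g 0 \<le> g t"
proof (rule ccontr)
  assume neg: "\<not> g 0 \<le> g t"
  define A where "A = {r \<in> {0..t}. g 0 \<le> g r}"
  have "closed A"
    unfolding A_def
    by (intro continuous_on_closed_Collect_le continuous_intros continuous_on_subset[OF cont]) auto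
  moreover have "0 \<in> A" "bdd_above A"
    using \<open>0 \<le> t\<close> by (auto simp: A_def bdd_above_def)
  moreover define r where "r = Sup A"
  ultimately have "r \<in> A"
    by (auto intro: closed_contains_Sup)
  have above: "q \<notin> A" if "r < q" for q
    using that \<open>bdd_above A\<close> unfolding r_def by (meson cSup_upper not_le)
  have r: "0 \<le> r" "r < t" "g 0 \<le> g r"
    using \<open>r \<in> A\<close> neg by (auto simp: A_def order_less_le)
  have "continuous (at r within {0..}) g"
    using cont r by (simp add: continuous_on_eq_continuous_within)
  then have "eventually (\<lambda>q. s < g q) (at r within {0..})"
    using r start by (intro order_tendstoD(1)[where y = "g r"]) (auto simp: continuous_within)
  then obtain d where d: "0 < d" "\<And>q. q \<ge> 0 \<Longrightarrow> q \<noteq> r \<Longrightarrow> dist q r < d \<Longrightarrow> s < g q"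
    unfolding eventually_at by auto
  define q where "q = min t (r + d / 2)"
  have q: "r < q" "q \<le> t" "q < r + d"
    using r d by (auto simp: q_def)
  have "g r < g q"
  proof (rule DERIV_pos_imp_increasing_open[OF q(1)])
    show "\<exists>y. (g has_real_derivative y) (at x) \<and> 0 < y" if "r < x" "x < q" for x
      using that r q deriv[of x] pos[of x] d(2)[of x] by (auto simp: dist_real_def)
    show "continuous_on {r..q} g"
      using r by (intro continuous_on_subset[OF cont]) auto
  qed
  then have "q \<in> A"
    using q r by (auto simp: A_def)
  then show False
    using above q by blast
qed

text \<open>Separation of variables: for a primitive \<open>F\<close> of \<open>1 / f\<close>, the function \<open>F \<circ> g\<close> grows at least at
  rate \<open>\<delta>\<close>, whereas the integrability of \<open>1 / f\<close> at infinity bounds \<open>F\<close> from above.\<close>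

lemma osgood_no_global_supersolution:
  fixes f g :: "real \<Rightarrow> real"
  assumes f: "continuous_on {0<..} f" "\<And>v. 0 < v \<Longrightarrow> 0 < f v"
    and int: "set_integrable lborel {1..} (\<lambda>v. 1 / f v)"
    and cont: "continuous_on {0..} g"
    and deriv: "\<And>t. 0 < t \<Longrightarrow> (g has_real_derivative g' t) (at t)"
    and low: "0 < m" "\<And>t. 0 \<le> t \<Longrightarrow> m \<le> g t"
    and "0 < \<delta>" and growth: "\<And>t. 0 < t \<Longrightarrow> \<delta> * f (g t) \<le> g' t"
  shows False
proof -
  \<comment> \<open>The base point of \<open>F\<close> lies strictly below the range of \<open>g\<close>, so that \<open>F\<close> is differentiable
    there, and below \<open>1\<close>, so that \<open>F\<close> splits at the point where integrability is known.\<close>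
  define c where "c = min 1 m / 2"
  have c: "0 < c" "c < 1" "c < m"
    using low(1) by (auto simp: c_def min_def)
  define F where "F v = integral {c..v} (\<lambda>s. 1 / f s)" for v
  have cf: "continuous_on {c..v} (\<lambda>s. 1 / f s)" for v
  proof (intro continuous_intros)
    show "continuous_on {c..v} f"
      using c by (intro continuous_on_subset[OF f(1)]) auto
    show "\<forall>s\<in>{c..v}. f s \<noteq> 0"
      using c f(2) by (metis atLeastAtMost_iff less_le_trans less_irrefl)
  qed
  have nonneg: "0 \<le> 1 / f s" if "c \<le> s" for s
    using that c f(2)[of s] by simp
  have ci: "(\<lambda>s. 1 / f s) integrable_on {c..v}" for v
    by (rule integrable_continuous_real[OF cf])
  have I: "(\<lambda>s. 1 / f s) integrable_on {1..}"
    using set_borel_integral_eq_integral(1)[OF int] .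
  have F_deriv: "(F has_real_derivative 1 / f v) (at v)" if "c < v" for v
  proof -
    have "(F has_real_derivative 1 / f v) (at v within {c..v + 1})"
      unfolding F_def by (rule integral_has_real_derivative[OF cf]) (use that in simp)
    moreover have "at v within {c..v + 1} = at v"
      by (rule at_within_Icc_at) (use that in simp_all)
    ultimately show ?thesis by simp
  qed
  have F_bound: "F v \<le> F 1 + integral {1..} (\<lambda>s. 1 / f s)" for v
  proof -
    have "F v \<le> F (max 1 v)"
      unfolding F_def by (rule integral_subset_le) (use nonneg ci in auto)
    also have "F (max 1 v) = F 1 + integral {1..max 1 v} (\<lambda>s. 1 / f s)"
      unfolding F_def using c ci
      by (intro Henstock_Kurzweil_Integration.integral_combine[symmetric]) auto
    also have "integral {1..max 1 v} (\<lambda>s. 1 / f s) \<le> integral {1..} (\<lambda>s. 1 / f s)"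
      by (rule integral_subset_le)
        (use nonneg c I in \<open>auto intro: integrable_on_subinterval[OF ci[of "max 1 v"]]\<close>)
    finally show ?thesis by simp
  qed
  have linear: "\<delta> * t \<le> F (g t) - F (g 0)" if t: "0 < t" for t
  proof -
    have Fg: "((\<lambda>t. F (g t)) has_real_derivative 1 / f (g r) * g' r) (at r)" if "0 < r" for r
      using low(2)[of r] c that by (intro DERIV_chain2[OF F_deriv deriv]) auto
    have "continuous_on {0..} (\<lambda>t. F (g t))"
    proof (rule continuous_on_compose2[OF _ cont])
      show "continuous_on {c<..} F"
        by (intro DERIV_continuous_on[where D = "\<lambda>v. 1 / f v"])
          (auto intro: has_field_derivative_at_within F_deriv)
      show "g ` {0..} \<subseteq> {c<..}"
        using low(2) c by force
    qed
    then have "continuous_on {0..t} (\<lambda>t. F (g t))"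
      by (rule continuous_on_subset) auto
    moreover have "(\<lambda>t. F (g t)) differentiable (at r)" if "0 < r" for r
      using Fg[OF that] by (auto simp: real_differentiable_def)
    ultimately obtain l r where r: "0 < r" "r < t" "DERIV (\<lambda>t. F (g t)) r :> l"
      "F (g t) - F (g 0) = (t - 0) * l"
      using MVT[OF t, of "\<lambda>t. F (g t)"] by auto
    have "l = g' r / f (g r)"
      using DERIV_unique[OF r(3) Fg[OF r(1)]] by simp
    moreover have "0 < f (g r)"
      using low(1) low(2)[of r] r by (intro f(2)) auto
    ultimately have "\<delta> \<le> l"
      using growth[OF r(1)] by (simp add: pos_le_divide_eq)
    then show ?thesis
      using r t by (simp add: mult.commute)
  qed
  define K where "K = F 1 + integral {1..} (\<lambda>s. 1 / f s) - F (g 0)"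
  define t where "t = \<bar>K\<bar> / \<delta> + 1"
  have "0 < t"
    using \<open>0 < \<delta>\<close> by (simp add: t_def add_nonneg_pos)
  then have "\<delta> * t \<le> K"
    using linear[of t] F_bound[of "g t"] by (simp add: K_def)
  moreover have "\<delta> * t = \<bar>K\<bar> + \<delta>"
    using \<open>0 < \<delta>\<close> by (simp add: t_def distrib_left)
  ultimately show False
    using \<open>0 < \<delta>\<close> by linarith
qed

text \<open>The barrier keeps \<open>g\<close> above \<open>g 0\<close>, where \<open>f v \<ge> L * v\<close> with \<open>L = f (g 0) / g 0 > \<kappa>\<close>. Therefore
  \<open>\<kappa> * v\<close> is at most the fraction \<open>\<kappa> / L < 1\<close> of \<open>f v\<close>, and the linear damping only costs a
  constant factor in Osgood's criterion.\<close>

lemma superlinear_ode_no_global_supersolution: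
  fixes f g :: "real \<Rightarrow> real"
  assumes f: "continuous_on {0..} f" "convex_on {0..} f" "f 0 = 0" "\<And>v. 0 < v \<Longrightarrow> 0 < f v"
    and int: "set_integrable lborel {1..} (\<lambda>v. 1 / f v)"
    and lim: "filterlim (\<lambda>v. f v / v) at_top at_top"
    and "0 \<le> \<kappa>"
    and cont: "continuous_on {0..} g"
    and deriv: "\<And>t. 0 < t \<Longrightarrow> (g has_real_derivative g' t) (at t)"
    and ineq: "\<And>t. 0 < t \<Longrightarrow> f (g t) - \<kappa> * g t \<le> g' t"
    and start: "s0 f \<kappa> < g 0"
  shows False
proof -
  note slope = slope_above_threshold[OF f(2,3) lim]
  have g_low: "g 0 \<le> g t" if "0 \<le> t" for t
  proof (rule derivative_barrier[OF cont deriv _ start that])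
    fix t :: real assume "0 < t" "s0 f \<kappa> < g t"
    then show "0 < g' t"
      using slope[of \<kappa> "g t"] ineq[of t] by (simp add: pos_less_divide_eq)
  qed
  define L where "L = f (g 0) / g 0"
  have L: "0 < g 0" "\<kappa> < L"
    using slope[OF start] by (auto simp: L_def)
  show False
  proof (rule osgood_no_global_supersolution[OF _ f(4) int cont deriv L(1) g_low])
    show "continuous_on {0<..} f"
      using f(1) by (rule continuous_on_subset) auto
    show "0 < 1 - \<kappa> / L"
      using L \<open>0 \<le> \<kappa>\<close> by simp
    fix t :: real assume "0 < t"
    then have "0 < g t" "L \<le> f (g t) / g t"
      using g_low[of t] L(1) convex_slope_mono[OF f(2,3) L(1), of "g t"] by (auto simp: L_def)
    then have "L * g t \<le> f (g t)"
      by (simp add: pos_le_divide_eq)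
    then have "\<kappa> * (L * g t) \<le> \<kappa> * f (g t)"
      using \<open>0 \<le> \<kappa>\<close> by (rule mult_left_mono)
    then have "(\<kappa> * g t) * L \<le> \<kappa> * f (g t)"
      by (simp only: mult_ac)
    then have "\<kappa> * g t \<le> \<kappa> * f (g t) / L"
      using L \<open>0 \<le> \<kappa>\<close> by (subst pos_le_divide_eq) linarith+
    then have "\<kappa> * g t \<le> \<kappa> / L * f (g t)"
      by simp
    then show "(1 - \<kappa> / L) * f (g t) \<le> g' t"
      using ineq[OF \<open>0 < t\<close>] by (simp add: left_diff_distrib)
  qed
qed

section \<open>Homogeneous trees\<close>

context homogeneous_tree
begin

definition level :: "'a \<Rightarrow> nat" where
  "level x = comb_dist X \<omega> x x0"

definition neighbours :: "'a \<Rightarrow> 'a set" where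
  "neighbours x = {y. (x, y) \<in> edges X \<omega>}"

definition children :: "'a \<Rightarrow> 'a set" where
  "children x = {y. (x, y) \<in> edges X \<omega> \<and> level y = level x + 1}"

definition ball_at_root :: "nat \<Rightarrow> 'a set" where
  "ball_at_root R = {x \<in> X. level x \<le> R}"

lemma edge_sym: "(x, y) \<in> edges X \<omega> \<Longrightarrow> (y, x) \<in> edges X \<omega>"
  using weight_sym by (auto simp: edges_def)

lemma edge_in: "(x, y) \<in> edges X \<omega> \<Longrightarrow> x \<in> X \<and> y \<in> X"
  by (simp add: edges_def)

lemma level_root_iff: "x \<in> X \<Longrightarrow> level x = 0 \<longleftrightarrow> x = x0"
proof
  assume "x \<in> X" "level x = 0"
  have "\<exists>n. (x, x0) \<in> edges X \<omega> ^^ n"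
    using connected \<open>x \<in> X\<close> root_in by (auto simp: graph_connected_def rtrancl_power)
  then have "(x, x0) \<in> edges X \<omega> ^^ level x"
    unfolding level_def comb_dist_def by (rule LeastI_ex)
  then show "x = x0"
    using \<open>level x = 0\<close> by simp
next
  assume "x = x0"
  then show "level x = 0"
    unfolding level_def comb_dist_def by (intro Least_eq_0) simp
qed

lemma parent_exists:
  assumes "y \<in> X" "y \<noteq> x0"
  shows "\<exists>x\<in>X. y \<in> children x"
  using unique_parent[OF assms] edge_sym edge_in
  unfolding children_def level_def by force

lemma children_disjoint:
  assumes "y \<in> children x" "y \<in> children x'"
  shows "x = x'"
proof -
  have y: "y \<in> X" "level y \<noteq> 0"
    using assms(1) edge_in by (auto simp: children_def)
  then have "y \<noteq> x0"
    using level_root_iff[of y] by auto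
  from unique_parent[OF y(1) this] show ?thesis
    using assms edge_sym unfolding children_def level_def by force
qed

lemma children_subset: "children x \<subseteq> neighbours x"
  by (auto simp: children_def neighbours_def)

text \<open>Weights take only the values \<open>0\<close> and \<open>1\<close>, so that summability forces each vertex to have finitely
  many neighbours.\<close>

lemma
  assumes "x \<in> X"
  shows finite_neighbours: "finite (neighbours x)"
    and degree_eq_card: "degree X \<omega> x = real (card (neighbours x))"
    and laplacian_eq_sum: "laplacian X \<omega> \<mu> g x = (\<Sum>y\<in>neighbours x. g y) - degree X \<omega> x * g x"
proof -
  have sub: "neighbours x \<subseteq> X"
    using edge_in by (auto simp: neighbours_def)
  have w: "\<omega> x y = (if y \<in> neighbours x then 1 else 0)" if "y \<in> X" for y
    using unit_weights[OF assms that] by (auto simp: neighbours_def)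
  have "card G \<le> nat \<lfloor>degree X \<omega> x\<rfloor>" if "finite G" "G \<subseteq> neighbours x" for G
  proof -
    have "sum (\<omega> x) G = (\<Sum>y\<in>G. 1)"
      using that sub by (intro sum.cong) (auto simp: w subset_iff)
    then have "real (card G) = sum (\<omega> x) G"
      by simp
    also have "\<dots> \<le> degree X \<omega> x"
      unfolding degree_def using that sub
      by (intro finite_sum_le_infsum weight_summable assms) (auto intro: weight_nonneg assms)
    finally show ?thesis
      by (simp add: le_nat_floor)
  qed
  then show fin: "finite (neighbours x)"
    by (metis finite_if_finite_subsets_card_bdd)
  have "degree X \<omega> x = infsum (\<lambda>_. 1) (neighbours x)"
    unfolding degree_def using sub w by (intro infsum_cong_neutral) auto
  then show deg: "degree X \<omega> x = real (card (neighbours x))"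
    using fin by simp
  have "(\<Sum>\<^sub>\<infinity>y\<in>X. \<omega> x y * (g y - g x)) = infsum (\<lambda>y. g y - g x) (neighbours x)"
    using sub w by (intro infsum_cong_neutral) auto
  also have "\<dots> = (\<Sum>y\<in>neighbours x. g y) - degree X \<omega> x * g x"
    using fin deg by (simp add: sum_subtractf)
  finally show "laplacian X \<omega> \<mu> g x = (\<Sum>y\<in>neighbours x. g y) - degree X \<omega> x * g x"
    by (simp add: laplacian_def unit_measure assms)
qed

lemma degree_eq_branching:
  assumes "x \<in> X"
  shows "degree X \<omega> x = real b + (if x = x0 then 0 else 1)"
proof (cases "x = x0")
  case True
  then show ?thesis
    using branching_const[of 0] by (simp add: branching_def)
next
  case False
  then have "level x \<noteq> 0"
    using level_root_iff[OF assms] by simp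
  have "sphere_degree X \<omega> x0 (level x) = degree X \<omega> x"
    unfolding sphere_degree_def
  proof (rule the_equality)
    show "\<forall>y\<in>sphere_at X \<omega> x0 (level x). degree X \<omega> y = degree X \<omega> x"
      by (intro ballI degree_radial) (use assms in \<open>auto simp: sphere_at_def level_def\<close>)
    show "d = degree X \<omega> x" if "\<forall>y\<in>sphere_at X \<omega> x0 (level x). degree X \<omega> y = d" for d
      using that assms by (auto simp: sphere_at_def level_def)
  qed
  then show ?thesis
    using branching_const[of "level x"] \<open>level x \<noteq> 0\<close> False by (simp add: branching_def)
qed

text \<open>The root has \<open>b\<close> neighbours; every other vertex has \<open>b + 1\<close>, one of which is its parent.\<close>

lemma card_children_le:
  assumes "x \<in> X"
  shows "card (children x) \<le> b"
proof (cases "x = x0")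
  case True
  have "real (card (children x)) \<le> degree X \<omega> x"
    using card_mono[OF finite_neighbours[OF assms] children_subset] assms
    by (simp add: degree_eq_card)
  then show ?thesis
    using True degree_eq_branching[OF assms] by simp
next
  case False
  then obtain p where p: "x \<in> children p"
    using parent_exists assms by blast
  have "insert p (children x) \<subseteq> neighbours x" "p \<notin> children x"
    using p by (auto simp: children_def neighbours_def intro: edge_sym)
  moreover have "finite (children x)"
    using finite_subset[OF children_subset finite_neighbours[OF assms]] .
  ultimately have "card (children x) + 1 \<le> card (neighbours x)"
    using card_mono[OF finite_neighbours[OF assms], of "insert p (children x)"] by simp
  then show ?thesis
    using False degree_eq_branching[OF assms] degree_eq_card[OF assms] by simp
qed

lemma sphere_growth: "finite {x \<in> X. level x = r} \<and> card {x \<in> X. level x = r} \<le> b ^ r"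
proof (induction r)
  case 0
  have "{x \<in> X. level x = 0} = {x0}"
    using root_in by (auto simp: level_root_iff)
  then show ?case by simp
next
  case (Suc r)
  let ?S = "{x \<in> X. level x = r}"
  have sub: "{x \<in> X. level x = Suc r} \<subseteq> (\<Union>x\<in>?S. children x)"
  proof
    fix y assume "y \<in> {x \<in> X. level x = Suc r}"
    then have y: "y \<in> X" "y \<noteq> x0" "level y = Suc r"
      using level_root_iff[of y] by auto
    then obtain x where "x \<in> X" "y \<in> children x"
      using parent_exists by blast
    then show "y \<in> (\<Union>x\<in>?S. children x)"
      using y by (auto simp: children_def)
  qed
  have fin: "finite (\<Union>x\<in>?S. children x)"
    using Suc by (intro finite_UN_I finite_subset[OF children_subset finite_neighbours]) auto
  have "card {x \<in> X. level x = Suc r} \<le> card (\<Union>x\<in>?S. children x)"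
    by (rule card_mono[OF fin sub])
  also have "\<dots> \<le> (\<Sum>x\<in>?S. card (children x))"
    using Suc by (intro card_UN_le) auto
  also have "\<dots> \<le> of_nat (card ?S) * b"
    by (rule sum_bounded_above) (auto intro: card_children_le)
  also have "\<dots> \<le> b ^ r * b"
    using Suc by (intro mult_right_mono) auto
  finally show ?case
    using finite_subset[OF sub fin] by (simp add: mult.commute)
qed

lemma ball_at_root_eq: "ball_at_root R = (\<Union>r\<le>R. {x \<in> X. level x = r})"
  unfolding ball_at_root_def by blast

lemma finite_ball_at_root: "finite (ball_at_root R)"
  unfolding ball_at_root_eq by (intro finite_UN_I conjunct1[OF sphere_growth]) simp

lemma branching_less_exp: "ln (real b) < a \<Longrightarrow> real b < exp a"
  using b_pos by (metis exp_less_mono exp_ln less_le_trans of_nat_0_less_iff zero_less_one)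

text \<open>With \<open>z = b * exp (- a) < 1\<close>, the vertices at level \<open>r\<close> contribute at most \<open>z ^ r\<close> to the sum of
  \<open>exp (- a * level x)\<close>, and \<open>1 - z\<close> normalises the geometric series.\<close>

lemma sum_exp_level_le_1:
  assumes "ln (real b) < a"
  shows "(\<Sum>x\<in>ball_at_root R. (1 - real b * exp (- a)) * exp (- a * real (level x))) \<le> 1"
proof -
  define z where "z = real b * exp (- a)"
  have "real b < exp a"
    using assms by (rule branching_less_exp)
  then have z: "0 \<le> z" "z < 1"
    by (simp_all add: z_def exp_minus divide_inverse[symmetric])
  have "(\<Sum>x\<in>ball_at_root R. exp (- a * real (level x)))
      = (\<Sum>r\<le>R. \<Sum>x\<in>{x \<in> X. level x = r}. exp (- a * real (level x)))"
    unfolding ball_at_root_eq using sphere_growth by (intro sum.UNION_disjoint) auto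
  also have "\<dots> \<le> (\<Sum>r\<le>R. z ^ r)"
  proof (rule sum_mono)
    fix r
    have "(\<Sum>x\<in>{x \<in> X. level x = r}. exp (- a * real (level x)))
        = real (card {x \<in> X. level x = r}) * exp (- a) ^ r"
      by (simp add: exp_of_nat_mult[symmetric] mult.commute)
    also have "\<dots> \<le> real (b ^ r) * exp (- a) ^ r"
      using sphere_growth[of r] by (intro mult_right_mono) auto
    finally show "(\<Sum>x\<in>{x \<in> X. level x = r}. exp (- a * real (level x))) \<le> z ^ r"
      by (simp add: z_def power_mult_distrib)
  qed
  finally have "(1 - z) * (\<Sum>x\<in>ball_at_root R. exp (- a * real (level x))) \<le> (1 - z) * (\<Sum>r\<le>R. z ^ r)"
    using z by (intro mult_left_mono) auto
  also have "\<dots> = 1 - z ^ Suc R"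
    by (rule sum_gp_basic)
  also have "\<dots> \<le> 1"
    using z by simp
  finally show ?thesis
    by (simp add: sum_distrib_left z_def)
qed

text \<open>The Dirichlet-type estimate that replaces Green's formula. Of all the neighbours of \<open>x\<close> only the
  children are kept. Grouping their values by child, every vertex of the ball except the root
  occurs exactly once, through its parent, which belongs to the ball as well. This offsets the
  part of the degree in excess of \<open>b\<close>.\<close>

lemma sum_laplacian_ball_ge:
  assumes v: "\<And>x. x \<in> X \<Longrightarrow> 0 \<le> v x"
    and \<phi>: "\<And>x. x \<in> X \<Longrightarrow> 0 \<le> \<phi> x"
    and decreasing: "\<And>x y. x \<in> X \<Longrightarrow> y \<in> children x \<Longrightarrow> \<phi> y \<le> \<phi> x"
  shows "- real b * (\<Sum>x\<in>ball_at_root R. \<phi> x * v x)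
    \<le> (\<Sum>x\<in>ball_at_root R. \<phi> x * laplacian X \<omega> \<mu> v x)"
proof -
  let ?B = "ball_at_root R"
  have BX: "x \<in> X" if "x \<in> ?B" for x
    using that by (simp add: ball_at_root_def)
  have CX: "y \<in> X" if "y \<in> children x" for x y
    using that edge_in by (auto simp: children_def)
  have NX: "y \<in> X" if "y \<in> neighbours x" for x y
    using that edge_in by (auto simp: neighbours_def)
  have fC: "finite (children x)" if "x \<in> X" for x
    using finite_subset[OF children_subset finite_neighbours[OF that]] .
  have sub: "?B - {x0} \<subseteq> (\<Union>x\<in>?B. children x)"
  proof
    fix y assume y: "y \<in> ?B - {x0}"
    then obtain x where "x \<in> X" "y \<in> children x"
      using parent_exists BX by blast
    then show "y \<in> (\<Union>x\<in>?B. children x)"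
      using y by (force simp: children_def ball_at_root_def)
  qed
  have "(\<Sum>y\<in>?B - {x0}. \<phi> y * v y) \<le> (\<Sum>y\<in>(\<Union>x\<in>?B. children x). \<phi> y * v y)"
  proof (rule sum_mono2[OF _ sub])
    show "finite (\<Union>x\<in>?B. children x)"
      by (intro finite_UN_I finite_ball_at_root fC BX)
    fix y assume "y \<in> (\<Union>x\<in>?B. children x) - (?B - {x0})"
    then have "y \<in> X"
      using CX by blast
    then show "0 \<le> \<phi> y * v y"
      using \<phi> v by simp
  qed
  also have "\<dots> = (\<Sum>x\<in>?B. \<Sum>y\<in>children x. \<phi> y * v y)"
  proof (rule sum.UNION_disjoint[OF finite_ball_at_root])
    show "\<forall>x\<in>?B. finite (children x)"
      by (intro ballI fC BX)
    show "\<forall>x\<in>?B. \<forall>x'\<in>?B. x \<noteq> x' \<longrightarrow> children x \<inter> children x' = {}"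
      using children_disjoint by blast
  qed
  also have "\<dots> \<le> (\<Sum>x\<in>?B. \<Sum>y\<in>children x. \<phi> x * v y)"
  proof (intro sum_mono mult_right_mono)
    fix x y assume "x \<in> ?B" "y \<in> children x"
    then show "\<phi> y \<le> \<phi> x" "0 \<le> v y"
      using decreasing v BX CX by blast+
  qed
  also have "\<dots> \<le> (\<Sum>x\<in>?B. \<phi> x * (\<Sum>y\<in>neighbours x. v y))"
    unfolding sum_distrib_left[symmetric]
  proof (rule sum_mono)
    fix x assume "x \<in> ?B"
    then have "x \<in> X"
      by (rule BX)
    have "(\<Sum>y\<in>children x. v y) \<le> (\<Sum>y\<in>neighbours x. v y)"
      by (rule sum_mono2[OF finite_neighbours[OF \<open>x \<in> X\<close>] children_subset]) (use NX v in blast)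
    then show "\<phi> x * (\<Sum>y\<in>children x. v y) \<le> \<phi> x * (\<Sum>y\<in>neighbours x. v y)"
      by (rule mult_left_mono) (rule \<phi>[OF \<open>x \<in> X\<close>])
  qed
  finally have inflow: "(\<Sum>y\<in>?B - {x0}. \<phi> y * v y) \<le> (\<Sum>x\<in>?B. \<phi> x * (\<Sum>y\<in>neighbours x. v y))" .
  have "x0 \<in> ?B"
    using root_in level_root_iff[of x0] by (simp add: ball_at_root_def)
  then have "(\<Sum>x\<in>?B. (if x = x0 then 0 else 1) * (\<phi> x * v x)) = (\<Sum>y\<in>?B - {x0}. \<phi> y * v y)"
    by (simp add: sum.remove[OF finite_ball_at_root])
  moreover have "(\<Sum>x\<in>?B. degree X \<omega> x * (\<phi> x * v x))
      = (\<Sum>x\<in>?B. real b * (\<phi> x * v x) + (if x = x0 then 0 else 1) * (\<phi> x * v x))"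
    by (rule sum.cong) (simp_all only: degree_eq_branching[OF BX] distrib_right)
  ultimately have "(\<Sum>x\<in>?B. degree X \<omega> x * (\<phi> x * v x))
      = real b * (\<Sum>x\<in>?B. \<phi> x * v x) + (\<Sum>y\<in>?B - {x0}. \<phi> y * v y)"
    by (simp only: sum.distrib sum_distrib_left)
  moreover have "(\<Sum>x\<in>?B. \<phi> x * laplacian X \<omega> \<mu> v x)
      = (\<Sum>x\<in>?B. \<phi> x * (\<Sum>y\<in>neighbours x. v y)) - (\<Sum>x\<in>?B. degree X \<omega> x * (\<phi> x * v x))"
    unfolding sum_subtractf[symmetric]
    by (rule sum.cong) (simp_all add: laplacian_eq_sum BX right_diff_distrib)
  ultimately show ?thesis
    using inflow by linarith
qed

text \<open>Balls exhaust \<open>X\<close>. The bound \<open>0 \<le> s\<close> excludes a divergent series, to which \<open>infsum\<close> assigns the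
  value \<open>0\<close>.\<close>

lemma infsum_gt_imp_ball_sum_gt:
  fixes h :: "'a \<Rightarrow> real"
  assumes gt: "s < infsum h X" and "0 \<le> s"
  shows "\<exists>R. s < sum h (ball_at_root R)"
proof -
  have "h summable_on X"
    using assms infsum_not_exists[of h X] by (cases "h summable_on X") simp_all
  then have "(sum h \<longlongrightarrow> infsum h X) (finite_subsets_at_top X)"
    by (simp only: has_sum_infsum has_sum_def[symmetric])
  then have "eventually (\<lambda>F. s < sum h F) (finite_subsets_at_top X)"
    using gt by (rule order_tendstoD)
  then obtain F where F: "finite F" "F \<subseteq> X"
    and big: "\<forall>Y. finite Y \<and> F \<subseteq> Y \<and> Y \<subseteq> X \<longrightarrow> s < sum h Y"
    unfolding eventually_finite_subsets_at_top by metis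
  let ?B = "ball_at_root (Max (level ` F))"
  have "F \<subseteq> ?B" "?B \<subseteq> X"
    using F by (auto simp: ball_at_root_def)
  then have "s < sum h ?B"
    using big finite_ball_at_root by (simp only: simp_thms)
  then show ?thesis ..
qed

end

section \<open>Blow-up of solutions\<close>

theorem theorem4p6:
  fixes X :: "'a set" and \<omega>0 :: "'a \<Rightarrow> 'a \<Rightarrow> real" and \<mu>1 :: "'a \<Rightarrow> real" and x0 :: 'a
    and b :: nat and a \<Lambda> :: real and f :: "real \<Rightarrow> real" and u0 \<phi> :: "'a \<Rightarrow> real"
    and u :: "'a \<Rightarrow> real \<Rightarrow> real" and T :: ereal
  assumes "\<forall>v\<ge>0. 0 \<le> f v"
    and "local_lipschitz (UNIV :: real set) {0..} (\<lambda>_. f)"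
    and "convex_on {0..} f"
    and "f 0 = 0"
    and "\<forall>v>0. 0 < f v"
    and "set_integrable lborel {1..} (\<lambda>v. 1 / f v)"
    and "filterlim (\<lambda>v. f v / v) at_top at_top"
    and "homogeneous_tree X \<omega>0 \<mu>1 x0 b"
    and "a > ln (real b)"
    and "\<forall>x\<in>X. 0 \<le> u0 x"
    and "u0 \<in> ell_infty X"
    and "\<exists>x\<in>X. u0 x \<noteq> 0"
    and "is_maximal_solution X \<omega>0 \<mu>1 f u0 T u"
    and "\<forall>x\<in>X. \<phi> x = (1 - real b * exp (- a)) * exp (- a * real (comb_dist X \<omega>0 x x0))"
    and "\<Lambda> \<ge> real b"
    and "(\<Sum>\<^sub>\<infinity>x\<in>X. u0 x * \<phi> x) > s0 f \<Lambda>"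
  shows "blows_up_in_finite_time X T u"
proof -
  note f_conv = assms(3) and f_zero = assms(4) and f_lim = assms(7)
    and \<phi>_def = assms(14)[rule_format] and mass = assms(16)
  interpret homogeneous_tree X \<omega>0 \<mu>1 x0 b
    by (rule assms(8))
  have sol: "is_solution X \<omega>0 \<mu>1 f u0 T u"
    using assms(13) by (simp add: is_maximal_solution_def)
  have not_global: "T \<noteq> \<infinity>"
  proof
    assume "T = \<infinity>"
    have u_C1: "u x C1_differentiable_on {0<..}" if "x \<in> X" for x
      using sol that by (simp add: is_solution_def \<open>T = \<infinity>\<close> greaterThan_def)
    have u_cont: "continuous_on {0..} (u x)" if "x \<in> X" for x
      using sol that by (simp add: is_solution_def \<open>T = \<infinity>\<close> atLeast_def)
    have u_nonneg: "0 \<le> u x t" if "x \<in> X" "0 < t" for x t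
      using sol that by (simp add: is_solution_def \<open>T = \<infinity>\<close>)
    have u_init: "u x 0 = u0 x" if "x \<in> X" for x
      using sol that by (simp add: is_solution_def)
    have u_eq: "deriv (u x) t = laplacian X \<omega>0 \<mu>1 (\<lambda>y. u y t) x + f (u x t)"
      if "x \<in> X" "0 < t" for x t
      using sol that by (simp add: is_solution_def \<open>T = \<infinity>\<close> diff_eq_eq)
    have u_deriv: "(u x has_real_derivative deriv (u x) t) (at t)" if "x \<in> X" "0 < t" for x t
    proof -
      from u_C1[OF that(1)] that(2) obtain d where "(u x has_real_derivative d) (at t)"
        by (auto simp: C1_differentiable_on_def has_real_derivative_iff_has_vector_derivative)
      then show ?thesis
        using DERIV_imp_deriv by metis
    qed
    have "real b < exp a"
      using assms(9) by (rule branching_less_exp)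
    then have c_pos: "0 < 1 - real b * exp (- a)"
      by (simp add: exp_minus field_simps)
    have "1 \<le> exp a"
      using \<open>real b < exp a\<close> b_pos by linarith
    then have "0 \<le> a"
      by simp
    have \<phi>_pos: "0 < \<phi> x" if "x \<in> X" for x
      using c_pos that by (simp add: \<phi>_def)
    have \<phi>_decreasing: "\<phi> y \<le> \<phi> x" if "x \<in> X" "y \<in> children x" for x y
    proof -
      have "y \<in> X" "level y = level x + 1"
        using that edge_in by (auto simp: children_def)
      then show ?thesis
        using that c_pos \<open>0 \<le> a\<close>
        by (simp add: \<phi>_def level_def mult_left_mono)
    qed
    have \<phi>_mass: "(\<Sum>x\<in>ball_at_root R. \<phi> x) \<le> 1" for R
    proof -
      have "(\<Sum>x\<in>ball_at_root R. \<phi> x)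
          = (\<Sum>x\<in>ball_at_root R. (1 - real b * exp (- a)) * exp (- a * real (level x)))"
        by (rule sum.cong) (auto simp: ball_at_root_def \<phi>_def level_def)
      then show ?thesis
        using sum_exp_level_le_1[OF assms(9), of R] by simp
    qed

    \<comment> \<open>Some finite ball already carries enough initial mass to exceed the threshold.\<close>
    obtain R where R: "s0 f \<Lambda> < (\<Sum>x\<in>ball_at_root R. u0 x * \<phi> x)"
      using infsum_gt_imp_ball_sum_gt[OF mass s0_nonneg[OF f_lim]] by blast
    let ?B = "ball_at_root R"
    have BX: "x \<in> X" if "x \<in> ?B" for x
      using that by (simp add: ball_at_root_def)
    define g where "g t = (\<Sum>x\<in>?B. \<phi> x * u x t)" for t
    define g' where "g' t = (\<Sum>x\<in>?B. \<phi> x * deriv (u x) t)" for t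
    show False
    proof (rule superlinear_ode_no_global_supersolution)
      show "continuous_on {0..} f"
        by (rule local_lipschitz_continuous_on[OF assms(2)]) simp
      show "convex_on {0..} f" "f 0 = 0" "set_integrable lborel {1..} (\<lambda>v. 1 / f v)"
        "filterlim (\<lambda>v. f v / v) at_top at_top"
        by fact+
      show "0 < f v" if "0 < v" for v
        using assms(5) that by blast
      show "0 \<le> \<Lambda>"
        using assms(15) by linarith
      show "continuous_on {0..} g"
        unfolding g_def by (intro continuous_intros u_cont BX)
      show "s0 f \<Lambda> < g 0"
        using R by (simp add: g_def u_init BX mult.commute cong: sum.cong)
      fix t :: real assume "0 < t"
      show "(g has_real_derivative g' t) (at t)"
        unfolding g_def g'_def using \<open>0 < t\<close>
        by (intro DERIV_sum DERIV_cmult u_deriv BX)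
      have "0 \<le> g t"
        unfolding g_def using \<open>0 < t\<close>
        by (intro sum_nonneg mult_nonneg_nonneg u_nonneg less_imp_le[OF \<phi>_pos] BX)
      then have "f (g t) - \<Lambda> * g t \<le> - real b * g t + f (g t)"
        using mult_right_mono[OF assms(15)] by simp
      also have "- real b * g t \<le> (\<Sum>x\<in>?B. \<phi> x * laplacian X \<omega>0 \<mu>1 (\<lambda>y. u y t) x)"
        unfolding g_def
        by (rule sum_laplacian_ball_ge) (use u_nonneg \<open>0 < t\<close> \<phi>_pos \<phi>_decreasing in \<open>auto intro: less_imp_le\<close>)
      also have "f (g t) \<le> (\<Sum>x\<in>?B. \<phi> x * f (u x t))"
        unfolding g_def
        by (rule jensen_subprobability)
          (use f_conv f_zero finite_ball_at_root \<phi>_mass \<phi>_pos u_nonneg \<open>0 < t\<close> BX in auto)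
      finally show "f (g t) - \<Lambda> * g t \<le> g' t"
        using \<open>0 < t\<close>
        by (simp add: g'_def u_eq BX distrib_left sum.distrib cong: sum.cong)
    qed
  qed
  have "(\<lambda>x. u x t) \<in> ell_infty X" if "0 < t" "ereal t < T" for t
  proof -
    have "bounded ((\<lambda>(x, t). u x t) ` (X \<times> {0..t}))"
      using sol that by (simp add: is_solution_def)
    moreover have "(\<lambda>x. u x t) ` X \<subseteq> (\<lambda>(x, t). u x t) ` (X \<times> {0..t})"
      using that by force
    ultimately show ?thesis
      unfolding ell_infty_def using bounded_subset by blast
  qed
  then show ?thesis
    using assms(13) not_global sol
    by (auto simp: blows_up_in_finite_time_def is_maximal_solution_def is_global_def is_solution_def)
qed

end
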